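(* Let $G=(V=[N],E)$ be an $(e,d)$-depth-robust DAG, and let $H_G$ and $V_C$ be as in the context. Then the pair $(H_G,V_C)$ is $(s,\,d+1,\,s/|V_C|)$-hard for every $s\le e$.
   Context: A DAG is $(e,d)$-depth-robust if deleting any at most $e$ nodes leaves a directed path of length $d$. For a DAG $M$ with a set $I$ of $N$ inputs and a set $O$ of $N$ outputs, $M$ is $(k_1,k_2)$-ST-robust if for every $D\subseteq V(M)$ with $|D|\le k_1$ there is a subgraph $H$ of $M-D$ with $|I\cap V(H)|\ge k_2$, $|O\cap V(H)|\ge k_2$, such that every $s\in I\cap V(H)$ has a directed path in $H$ to every $t\in O\cap V(H)$; $M$ is maximally ST-robust if it is $(k,N-k)$-ST-robust for all $0\le k\le N$. The overlay graph $H_G$: start with a maximally ST-robust DAG with $N$ inputs $x_1,\dots,x_N$ and $N$ outputs $O$, and for every edge $(u,v)\in E$ add the edge $(x_u,x_v)$; fix a target set $V_C\subseteq O$. For a DAG $G'$, a node $v$ has depth $\ge t$ in $G'-S$ if there is a directed path of length $\ge t$ in $G'-S$ ending at $v$. A pair $(G',V_C)$ with $V_C\subseteq V(G')$ is $(s,t,\varepsilon)$-hard if for every $S\subseteq V(G')$ with $|S|\le s$, at least a $(1-\varepsilon)$ fraction of the nodes of $V_C$ have depth $\ge t$ in $G'-S$.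
   Formalization: The inputs and outputs of the ST-robust DAG are assumed disjoint; without this the claim fails, e.g. for N=1 with a single node that is both input and output and e=d=s=0, where that node has depth 0, not at least 1. *)

theory Defs
  imports Complex_Main "Graph_Theory.Graph_Theory"
begin

definition dag :: "('a, 'b) pre_digraph \<Rightarrow> bool" where
  "dag G \<longleftrightarrow> fin_digraph G \<and> (\<nexists>p. pre_digraph.cycle G p)"

definition delete_verts :: "('a, 'b) pre_digraph \<Rightarrow> 'a set \<Rightarrow> ('a, 'b) pre_digraph" where
  "delete_verts G S = G \<restriction> (verts G - S)"

text \<open>
  Directed paths are rendered by \<open>awalk\<close>; in a DAG every walk is a path (lemma
  \<open>dag_awalk_imp_apath\<close>), and the overlay is a DAG whenever the inputs are sources (lemma
  \<open>dag_overlay\<close>). The length of a path is its number of arcs. The empty path at \<open>u\<close>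
  requires \<open>u\<close> to be a vertex of the graph, so a graph without vertices contains no path at all.
\<close>

definition depth_robust :: "nat \<Rightarrow> nat \<Rightarrow> ('a, 'b) pre_digraph \<Rightarrow> bool" where
  "depth_robust e d G \<longleftrightarrow>
     (\<forall>S \<subseteq> verts G. card S \<le> e \<longrightarrow>
        (\<exists>u p v. pre_digraph.awalk (delete_verts G S) u p v \<and> length p = d))"

definition st_robust :: "nat \<Rightarrow> nat \<Rightarrow> ('a, 'b) pre_digraph \<Rightarrow> 'a set \<Rightarrow> 'a set \<Rightarrow> bool" where
  "st_robust k1 k2 M Inp Out \<longleftrightarrow>
     (\<forall>D \<subseteq> verts M. card D \<le> k1 \<longrightarrow>
        (\<exists>H. subgraph H (delete_verts M D) \<and>
             card (Inp \<inter> verts H) \<ge> k2 \<and> card (Out \<inter> verts H) \<ge> k2 \<and>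
             (\<forall>s \<in> Inp \<inter> verts H. \<forall>t \<in> Out \<inter> verts H. \<exists>p. pre_digraph.awalk H s p t)))"

definition maximally_st_robust ::
    "nat \<Rightarrow> ('a, 'b) pre_digraph \<Rightarrow> 'a set \<Rightarrow> 'a set \<Rightarrow> bool" where
  "maximally_st_robust N M Inp Out \<longleftrightarrow> (\<forall>k \<le> N. st_robust k (N - k) M Inp Out)"

definition overlay ::
    "'v pair_pre_digraph \<Rightarrow> 'a pair_pre_digraph \<Rightarrow> ('v \<Rightarrow> 'a) \<Rightarrow> 'a pair_pre_digraph" where
  "overlay G M x =
     \<lparr> pverts = pverts M, parcs = parcs M \<union> {(x u, x v) | u v. (u, v) \<in> parcs G} \<rparr>"

definition depth_ge :: "('a, 'b) pre_digraph \<Rightarrow> 'a \<Rightarrow> nat \<Rightarrow> bool" where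
  "depth_ge G v t \<longleftrightarrow> (\<exists>u p. pre_digraph.awalk G u p v \<and> length p \<ge> t)"

definition hard :: "nat \<Rightarrow> nat \<Rightarrow> real \<Rightarrow> ('a, 'b) pre_digraph \<Rightarrow> 'a set \<Rightarrow> bool" where
  "hard s t \<epsilon> G V\<^sub>C \<longleftrightarrow>
     (\<forall>S \<subseteq> verts G. card S \<le> s \<longrightarrow>
        real (card {v \<in> V\<^sub>C. depth_ge (delete_verts G S) v t}) \<ge> (1 - \<epsilon>) * real (card V\<^sub>C))"

lemma dag_awalk_imp_apath:
  assumes "dag G" "pre_digraph.awalk G u p v"
  shows "pre_digraph.apath G u p v"
proof -
  interpret fin_digraph G using assms(1) by (simp add: dag_def)
  show ?thesis
  proof (rule ccontr)
    assume "\<not> apath u p v"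
    then have "\<not> distinct (awalk_verts u p)" using assms(2) by (simp add: apath_def)
    then obtain q r s w where "awalk w r w" "r \<noteq> []"
      using awalk_not_distinct_decomp[OF assms(2)] by blast
    then have "closed_w r" by (auto simp: closed_w_def)
    then obtain c where "cycle c" 
      using closed_w_imp_cycle by blast
    then show False using assms(1) by (simp add: dag_def)
  qed
qed

lemma dag_with_proj_iff:
  "dag (with_proj G) \<longleftrightarrow> pair_fin_digraph G \<and> wf (parcs G)"
proof -
  have fin: "fin_digraph (with_proj G) \<longleftrightarrow> pair_fin_digraph G"
    by (auto simp: fin_digraph_def wf_digraph_def fin_digraph_axioms_def
        pair_fin_digraph_def pair_wf_digraph_def pair_fin_digraph_axioms_def)
  have "(\<nexists>p. pre_digraph.cycle (with_proj G) p) \<longleftrightarrow> wf (parcs G)" if "fin_digraph (with_proj G)"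
  proof -
    interpret fin_digraph "with_proj G" by (rule that)
    have "(\<exists>p. cycle p) \<longleftrightarrow> (\<exists>p. closed_w p)"
      using closed_w_imp_cycle by (auto simp: cycle_altdef)
    also have "\<dots> \<longleftrightarrow> (\<exists>u. (u, u) \<in> (parcs G)\<^sup>+)"
      by (auto simp: closed_w_def reachable1_awalk[simplified])
    finally show ?thesis
      using finite_arcs by (simp add: wf_iff_acyclic_if_finite acyclic_def)
  qed
  then show ?thesis by (auto simp: dag_def fin)
qed

lemma dag_overlay:
  fixes G :: "'v pair_pre_digraph" and M :: "'a pair_pre_digraph"
  assumes "dag G" "dag M" "inj_on x (pverts G)" "x ` pverts G \<subseteq> pverts M"
    and sources: "\<And>u v. (u, v) \<in> parcs M \<Longrightarrow> v \<notin> x ` pverts G"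
  shows "dag (overlay G M x)"
proof -
  interpret G: pair_fin_digraph G using assms(1) by (simp add: dag_with_proj_iff)
  interpret M: pair_fin_digraph M using assms(2) by (simp add: dag_with_proj_iff)
  let ?X = "{(x u, x v) | u v. (u, v) \<in> parcs G}"
  have X: "?X = (\<lambda>(u, v). (x u, x v)) ` parcs G" by auto
  have "?X \<subseteq> inv_image (parcs G) (inv_into (pverts G) x)"
    using assms(3) by (auto simp: G.in_arcsD1 G.in_arcsD2)
  moreover have "wf (parcs G)" using assms(1) by (simp add: dag_with_proj_iff)
  ultimately have "wf ?X" using wf_inv_image wf_subset by blast
  moreover have "wf (parcs M)" using assms(2) by (simp add: dag_with_proj_iff)
  moreover have "Domain ?X \<inter> Range (parcs M) = {}"
    using sources G.in_arcsD1 by blast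
  ultimately have "wf (?X \<union> parcs M)" by (rule wf_Un)
  moreover have "pair_fin_digraph (overlay G M x)"
  proof
    show "finite (parcs (overlay G M x))"
      using G.pair_finite_arcs M.pair_finite_arcs by (simp add: overlay_def X)
    show "finite (pverts (overlay G M x))"
      using M.pair_finite_verts by (simp add: overlay_def)
    fix a assume "a \<in> parcs (overlay G M x)"
    then show "fst a \<in> pverts (overlay G M x)" "snd a \<in> pverts (overlay G M x)"
      using assms(4) G.in_arcsD1 G.in_arcsD2 M.in_arcsD1 M.in_arcsD2
      by (force simp: overlay_def)+
  qed
  ultimately show ?thesis by (simp add: dag_with_proj_iff overlay_def Un_commute)
qed

end

theory Submission
  imports Defs
begin

text \<open>
  Delete a set of \<open>k \<le> s\<close> nodes from the overlay. ST-robustness provides a subgraph of the rest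
  that keeps all but \<open>k\<close> of the inputs and of the outputs and joins each remaining input to each
  remaining output. Since \<open>k \<le> e\<close>, depth-robustness of \<open>G\<close> gives a path of length \<open>d\<close> through the
  remaining inputs, and it can be prolonged by at least one arc to every remaining output.
\<close>

lemma wf_digraph_delete_verts:
  assumes "wf_digraph G"
  shows "wf_digraph (delete_verts G S)"
  by (simp add: wf_digraph_def delete_verts_def)

text \<open>In a pair digraph tail and head are \<open>fst\<close> and \<open>snd\<close>, whatever
  the arc set. So \<open>cas\<close> is pure chaining of pairs and survives any map into any
  \<open>H\<close>; membership of the arcs is checked separately.\<close>

lemma cas_with_proj_map:
  assumes "pre_digraph.cas (with_proj G) u p v"
  shows "pre_digraph.cas (with_proj H) (f u) (map (map_prod f f) p) (f v)"
  using assms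
  by (induction p arbitrary: u) (auto simp: pre_digraph.cas.simps)

text \<open>Deletion keeps the tail and head functions, and \<open>cas\<close> consults nothing
  else.\<close>

lemma cas_delete_verts:
  "pre_digraph.cas (delete_verts G S) = pre_digraph.cas G"
proof (intro ext)
  show "pre_digraph.cas (delete_verts G S) u p v = pre_digraph.cas G u p v" for u p v
    by (induction p arbitrary: u) (simp_all add: pre_digraph.cas.simps delete_verts_def)
qed

text \<open>This carries the path supplied by depth-robustness over to the inputs: each arc
  \<open>(a, b)\<close> of \<open>G\<close> has its copy \<open>(x a, x b)\<close> in the overlay,
  and \<open>x\<close> keeps the surviving nodes clear of \<open>S\<close>.\<close>

lemma awalk_overlay_map:
  assumes walk: "pre_digraph.awalk (delete_verts (with_proj G) T) u p v"
    and x: "\<And>w. w \<in> pverts G - T \<Longrightarrow> x w \<in> pverts M - S"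
  shows "pre_digraph.awalk (delete_verts (with_proj (overlay G M x)) S)
           (x u) (map (map_prod x x) p) (x v)"
proof -
  have "pre_digraph.cas (with_proj G) u p v"
    using walk by (simp add: pre_digraph.awalk_def cas_delete_verts)
  then have "pre_digraph.cas (with_proj (overlay G M x)) (x u) (map (map_prod x x) p) (x v)"
    by (rule cas_with_proj_map)
  moreover have "x u \<in> pverts M - S"
    using walk x by (simp add: pre_digraph.awalk_def delete_verts_def)
  moreover have "map_prod x x a \<in> arcs (delete_verts (with_proj (overlay G M x)) S)"
    if "a \<in> set p" for a
  proof -
    have "a \<in> parcs G" "fst a \<in> pverts G - T" "snd a \<in> pverts G - T"
      using walk that by (auto simp: pre_digraph.awalk_def delete_verts_def)
    moreover from this have "x (fst a) \<in> pverts M - S" "x (snd a) \<in> pverts M - S"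
      using x by blast+
    ultimately show ?thesis
      by (cases a) (auto simp: delete_verts_def overlay_def)
  qed
  ultimately show ?thesis
    by (auto simp: pre_digraph.awalk_def cas_delete_verts)
      (auto simp: delete_verts_def overlay_def)
qed

lemma awalk_delete_verts_overlay:
  assumes "pre_digraph.awalk (delete_verts (with_proj M) S) u p v"
  shows "pre_digraph.awalk (delete_verts (with_proj (overlay G M x)) S) u p v"
proof -
  have "pre_digraph.cas (with_proj M) u p v"
    using assms by (simp add: pre_digraph.awalk_def cas_delete_verts)
  then have "pre_digraph.cas (with_proj (overlay G M x)) u p v"
    \<comment> \<open>Mapping along \<open>id\<close> changes only the ambient graph.\<close>
    using cas_with_proj_map[of M u p v "overlay G M x" id] by (simp add: prod.map_id0)
  then show ?thesis
    using assms by (auto simp: pre_digraph.awalk_def cas_delete_verts)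
      (auto simp: delete_verts_def overlay_def)
qed

lemma wf_digraph_overlay:
  assumes "wf_digraph (with_proj G)" "wf_digraph (with_proj M)" "x ` pverts G \<subseteq> pverts M"
  shows "wf_digraph (with_proj (overlay G M x))"
  using assms by (auto simp: wf_digraph_def overlay_def)

text \<open>Once all vertices are deleted not even an empty walk is left, so the deletion budget
  must stay below the number of vertices.\<close>

lemma depth_robust_imp_less_card_verts:
  assumes "depth_robust e d G"
  shows "e < card (verts G)"
proof (rule ccontr)
  assume "\<not> e < card (verts G)"
  then obtain u p v where "pre_digraph.awalk (delete_verts G (verts G)) u p v"
    using assms unfolding depth_robust_def by (meson not_less subset_refl)
  then show False by (simp add: pre_digraph.awalk_def delete_verts_def)
qed

theorem theorem6:
  fixes G :: "nat pair_pre_digraph" and M :: "'a pair_pre_digraph"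
    and x :: "nat \<Rightarrow> 'a" and Out V\<^sub>C :: "'a set" and N e d s :: nat
  assumes "pverts G = {1..N}" and "dag G" and "depth_robust e d G"
    and "dag M"
    and "inj_on x {1..N}" and "x ` {1..N} \<subseteq> pverts M"
    and "Out \<subseteq> pverts M" and "card Out = N"
    and "x ` {1..N} \<inter> Out = {}"
    and "maximally_st_robust N M (x ` {1..N}) Out"
    and "V\<^sub>C \<subseteq> Out"
    and "s \<le> e"
  shows "hard s (d + 1) (real s / real (card V\<^sub>C)) (overlay G M x) V\<^sub>C"
  unfolding hard_def
proof (intro allI impI)
  fix S assume "S \<subseteq> verts (with_proj (overlay G M x))" and S_card: "card S \<le> s"
  then have S: "S \<subseteq> pverts M" by (simp add: overlay_def)
  let ?I = "x ` {1..N}"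
  let ?O = "delete_verts (with_proj (overlay G M x)) S"
  have wf: "wf_digraph (with_proj G)" "wf_digraph (with_proj M)"
    using assms(2,4) by (auto simp: dag_def fin_digraph_def)
  then interpret O: wf_digraph ?O
    using assms(1,6) by (intro wf_digraph_delete_verts wf_digraph_overlay) auto
  have finite_Out: "finite Out"
    using assms(4,7) finite_subset by (auto simp: dag_def fin_digraph_def fin_digraph_axioms_def)
  \<comment> \<open>This bound admits \<open>k = card S\<close> in maximal ST-robustness and keeps
    \<open>N - card S\<close> from being truncated.\<close>
  have "card S \<le> N"
    using depth_robust_imp_less_card_verts[OF assms(3)] assms(1,12) S_card by simp
  then have "st_robust (card S) (N - card S) M ?I Out"
    using assms(10) by (simp add: maximally_st_robust_def)
  then have "\<exists>H. subgraph H (delete_verts (with_proj M) S) \<and>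
      card (?I \<inter> verts H) \<ge> N - card S \<and> card (Out \<inter> verts H) \<ge> N - card S \<and>
      (\<forall>a \<in> ?I \<inter> verts H. \<forall>b \<in> Out \<inter> verts H. \<exists>p. pre_digraph.awalk H a p b)"
    using S by (simp add: st_robust_def)
  then obtain H where sub: "subgraph H (delete_verts (with_proj M) S)"
    and H_in: "card (?I \<inter> verts H) \<ge> N - card S"
    and H_out: "card (Out \<inter> verts H) \<ge> N - card S"
    and H_walk: "\<And>a b. a \<in> ?I \<inter> verts H \<Longrightarrow> b \<in> Out \<inter> verts H \<Longrightarrow>
      \<exists>p. pre_digraph.awalk H a p b"
    by blast
  have H_verts: "verts H \<subseteq> pverts M - S"
    using sub by (auto simp: subgraph_def delete_verts_def)
  \<comment> \<open>The inputs missing from \<open>H\<close> may include some outside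
    \<open>S\<close>; all of them have to be avoided, since only inputs in \<open>H\<close> are
    known to reach the outputs in \<open>H\<close>.\<close>
  define T where "T = {u \<in> {1..N}. x u \<notin> verts H}"
  have "card T \<le> e"
  proof -
    have "?I \<inter> verts H = x ` ({1..N} - T)" by (auto simp: T_def)
    then have "card (?I \<inter> verts H) = card ({1..N} - T)"
      using assms(5) by (metis Diff_subset card_image inj_on_subset)
    also have "\<dots> = N - card T"
      by (subst card_Diff_subset) (auto simp: T_def)
    finally have "card (?I \<inter> verts H) = N - card T" .
    \<comment> \<open>With \<open>card T\<close> at most \<open>N\<close>, the natural-number
      differences can be compared to give \<open>card T \<le> card S\<close>.\<close>
    moreover have "card T \<le> card {1..N}" by (rule card_mono) (auto simp: T_def)
    ultimately show ?thesis using H_in \<open>card S \<le> N\<close> S_card assms(12) by simp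
  qed
  moreover have "T \<subseteq> verts (with_proj G)" by (auto simp: T_def assms(1))
  ultimately obtain u p v where p: "pre_digraph.awalk (delete_verts (with_proj G) T) u p v"
      and len: "length p = d"
    using assms(3) unfolding depth_robust_def by blast
  have T_verts: "x w \<in> verts H" if "w \<in> pverts G - T" for w
    using that by (simp add: T_def assms(1))
  have p_image: "O.awalk (x u) (map (map_prod x x) p) (x v)"
    using p T_verts H_verts by (intro awalk_overlay_map) auto
  \<comment> \<open>The end of the path is where the walk to an output gets attached; this also
    covers \<open>d = 0\<close>, where \<open>p\<close> is empty.\<close>
  have "v \<in> pverts G - T"
    using wf_digraph.awalk_last_in_verts[OF wf_digraph_delete_verts[OF wf(1)] p]
    by (simp add: delete_verts_def)
  then have v: "x v \<in> ?I \<inter> verts H" using T_verts by (auto simp: assms(1))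
  have deep: "depth_ge ?O t (d + 1)" if t: "t \<in> Out \<inter> verts H" for t
  proof -
    obtain q where "pre_digraph.awalk H (x v) q t" using H_walk[OF v t] by blast
    then have "pre_digraph.awalk (delete_verts (with_proj M) S) (x v) q t"
      using sub wf_digraph.subgraph_awalk_imp_awalk[OF wf_digraph_delete_verts[OF wf(2)]]
      by blast
    then have q: "O.awalk (x v) q t" by (rule awalk_delete_verts_overlay)
    \<comment> \<open>Inputs and outputs are disjoint, so \<open>q\<close> has at least one arc: the
      extra 1 in \<open>d + 1\<close>.\<close>
    have "q \<noteq> []" using q v t assms(9) by (auto simp: O.awalk_Nil_iff)
    then have "length (map (map_prod x x) p @ q) \<ge> d + 1"
      using len by (cases q) auto
    then show ?thesis
      using O.awalk_appendI[OF p_image q] unfolding depth_ge_def by blast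
  qed
  have fin_C: "finite V\<^sub>C" using finite_Out assms(11) finite_subset by blast
  \<comment> \<open>Only outputs outside \<open>H\<close> can fail to be deep, and \<open>H\<close>
    misses at most \<open>card S\<close> of them.\<close>
  have "card (Out - verts H) \<le> card S"
    using H_out assms(8) \<open>card S \<le> N\<close> card_Diff_subset_Int[of Out "verts H"] finite_Out by simp
  then have "card (V\<^sub>C - verts H) \<le> s"
    using S_card card_mono[of "Out - verts H" "V\<^sub>C - verts H"] finite_Out assms(11) by fastforce
  moreover have "card V\<^sub>C = card (V\<^sub>C \<inter> verts H) + card (V\<^sub>C - verts H)"
    using fin_C by (metis card_Int_Diff)
  moreover have "card (V\<^sub>C \<inter> verts H) \<le> card {t \<in> V\<^sub>C. depth_ge ?O t (d + 1)}"
    using fin_C deep assms(11) by (intro card_mono) auto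
  ultimately have "real (card V\<^sub>C) - real s \<le> real (card {t \<in> V\<^sub>C. depth_ge ?O t (d + 1)})"
    by linarith
  \<comment> \<open>For empty \<open>V\<^sub>C\<close> the quotient is 0 by the convention for
    division by zero, and both sides vanish.\<close>
  then show "(1 - real s / real (card V\<^sub>C)) * real (card V\<^sub>C)
      \<le> real (card {t \<in> V\<^sub>C. depth_ge ?O t (d + 1)})"
    by (cases "card V\<^sub>C = 0") (simp_all add: left_diff_distrib)
qed

end
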